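(* Let $\Phi=(A;\{E_i\}_{i=0}^d;A^*;\{E_i^*\}_{i=0}^d)$ be a tridiagonal system of diameter $d\geq 1$ on $V$ over $\mathbb{K}$, and let $\Delta\in\mathrm{End}(V)$ be the linear transformation attached to $\Phi$ as defined in the context. Suppose $\Delta'\in\mathrm{End}(V)$ satisfies, for $0\le i\le d$, both $$(\Delta'-I)E_i^*V\subseteq E_0^*V+E_1^*V+\cdots+E_{i-1}^*V,$$ $$\Delta'(E_iV+E_{i+1}V+\cdots+E_dV)\subseteq E_0V+E_1V+\cdots+E_{d-i}V.$$ Then $\Delta'=\Delta$.
   Context: $\mathbb{K}$ is a field, $V$ is a $\mathbb{K}$-vector space of finite positive dimension, $\mathrm{End}(V)$ is the algebra of linear maps $V\to V$, and $I$ is the identity. A tridiagonal pair (TD pair) on $V$ is an ordered pair $A,A^*\in\mathrm{End}(V)$ ($A^*$ is just a name, not an adjoint) such that: (i) $A$ and $A^*$ are each diagonalizable over $\mathbb{K}$; (ii) there is an ordering $\{V_i\}_{i=0}^d$ of the eigenspaces of $A$ with $A^*V_i\subseteq V_{i-1}+V_i+V_{i+1}$ for $0\le i\le d$, where $V_{-1}=V_{d+1}=0$; (iii) there is an ordering $\{V_i^*\}_{i=0}^{\delta}$ of the eigenspaces of $A^*$ with $AV_i^*\subseteq V_{i-1}^*+V_i^*+V_{i+1}^*$ for $0\le i\le\delta$, where $V_{-1}^*=V_{\delta+1}^*=0$; (iv) there is no subspace $W$ of $V$ with $AW\subseteq W$, $A^*W\subseteq W$, $W\ne0$, $W\ne V$.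 It is known that $d=\delta$; this is the diameter, and it is assumed that $d\ge1$. Orderings satisfying (ii) (resp. (iii)) are called standard. The primitive idempotent of a diagonalizable map associated with one of its eigenspaces is the projection of $V$ onto that eigenspace that kills the other eigenspaces. A tridiagonal system (TD system) on $V$ is a sequence $\Phi=(A;\{E_i\}_{i=0}^d;A^*;\{E_i^*\}_{i=0}^d)$ where $A,A^*$ is a TD pair on $V$, $\{E_i\}_{i=0}^d$ is an ordering of the primitive idempotents of $A$ such that $\{E_iV\}_{i=0}^d$ is standard, and $\{E_i^*\}_{i=0}^d$ is an ordering of the primitive idempotents of $A^*$ such that $\{E_i^*V\}_{i=0}^d$ is standard. For $0\le i\le d$ set $U_i=(E_0^*V+\cdots+E_i^*V)\cap(E_iV+\cdots+E_dV)$ and $U_i^{\Downarrow}=(E_0^*V+\cdots+E_i^*V)\cap(E_0V+\cdots+E_{d-i}V)$. It is known that $V=\bigoplus_{i=0}^dU_i=\bigoplus_{i=0}^dU_i^{\Downarrow}$ (first and second split decompositions). Let $F_i$ be the projection of $V$ onto $U_i$ along $\bigoplus_{j\ne i}U_j$, and $F_i^{\Downarrow}$ the projection of $V$ onto $U_i^{\Downarrow}$ along $\bigoplus_{j\ne i}U_j^{\Downarrow}$. Define $\Delta=\sum_{h=0}^dF_h^{\Downarrow}F_h$. An empty sum of subspaces is $0$. *)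

theory Defs
  imports Complex_Main "HOL-Library.Set_Algebras"
begin

text \<open>
  The vector space is the whole type, with scalar multiplication \<open>scale\<close>.
  Sums of subspaces are sums in the commutative monoid of sets from
  \<^theory>\<open>HOL-Library.Set_Algebras\<close>; in particular the empty sum is \<open>{0}\<close>.
  A sequence indexed by \<open>0, \<dots>, d\<close> is a function on \<^typ>\<open>nat\<close>
  whose values beyond \<open>d\<close> are irrelevant.
\<close>

locale fin_pos_dim_space = finite_dimensional_vector_space scale Basis
  for scale :: "'a::field \<Rightarrow> 'b::ab_group_add \<Rightarrow> 'b" (infixr "*s" 75) and Basis :: "'b set" +
  assumes dim_pos: "dim (UNIV :: 'b set) > 0"
begin

definition eigenspace :: "('b \<Rightarrow> 'b) \<Rightarrow> 'a \<Rightarrow> 'b set" where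
  "eigenspace T \<theta> = {v. T v = \<theta> *s v}"

definition eigenspaces :: "('b \<Rightarrow> 'b) \<Rightarrow> 'b set set" where
  "eigenspaces T = {eigenspace T \<theta> |\<theta>. \<exists>v. v \<noteq> 0 \<and> T v = \<theta> *s v}"

definition diagonalizable :: "('b \<Rightarrow> 'b) \<Rightarrow> bool" where
  "diagonalizable T \<longleftrightarrow> Vector_Spaces.linear scale scale T \<and> span (\<Union>(eigenspaces T)) = UNIV"

definition standard_ordering :: "('b \<Rightarrow> 'b) \<Rightarrow> ('b \<Rightarrow> 'b) \<Rightarrow> nat \<Rightarrow> (nat \<Rightarrow> 'b set) \<Rightarrow> bool" where
  "standard_ordering T S d W \<longleftrightarrow>
     bij_betw W {0..d} (eigenspaces T) \<and>
     (\<forall>i\<le>d. S ` W i \<subseteq> (if i = 0 then {0} else W (i - 1)) + W i + (if i = d then {0} else W (i + 1)))"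

definition TD_pair :: "('b \<Rightarrow> 'b) \<Rightarrow> ('b \<Rightarrow> 'b) \<Rightarrow> bool" where
  "TD_pair A As \<longleftrightarrow>
     diagonalizable A \<and> diagonalizable As \<and>
     (\<exists>d W. standard_ordering A As d W) \<and>
     (\<exists>\<delta> Ws. standard_ordering As A \<delta> Ws) \<and>
     \<not> (\<exists>W. subspace W \<and> A ` W \<subseteq> W \<and> As ` W \<subseteq> W \<and> W \<noteq> {0} \<and> W \<noteq> UNIV)"

definition is_projection :: "'b set \<Rightarrow> 'b set \<Rightarrow> ('b \<Rightarrow> 'b) \<Rightarrow> bool" where
  "is_projection W W' P \<longleftrightarrow>
     Vector_Spaces.linear scale scale P \<and> P \<circ> P = P \<and> range P = W \<and> {v. P v = 0} = W'"

definition primitive_idempotents :: "('b \<Rightarrow> 'b) \<Rightarrow> ('b \<Rightarrow> 'b) set" where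
  "primitive_idempotents T =
     {P. \<exists>W\<in>eigenspaces T. is_projection W (span (\<Union>(eigenspaces T - {W}))) P}"

definition TD_system ::
  "nat \<Rightarrow> ('b \<Rightarrow> 'b) \<Rightarrow> (nat \<Rightarrow> 'b \<Rightarrow> 'b) \<Rightarrow> ('b \<Rightarrow> 'b) \<Rightarrow> (nat \<Rightarrow> 'b \<Rightarrow> 'b) \<Rightarrow> bool" where
  "TD_system d A E As Es \<longleftrightarrow>
     TD_pair A As \<and>
     bij_betw E {0..d} (primitive_idempotents A) \<and>
     standard_ordering A As d (\<lambda>i. range (E i)) \<and>
     bij_betw Es {0..d} (primitive_idempotents As) \<and>
     standard_ordering As A d (\<lambda>i. range (Es i))"

definition split_U :: "nat \<Rightarrow> (nat \<Rightarrow> 'b \<Rightarrow> 'b) \<Rightarrow> (nat \<Rightarrow> 'b \<Rightarrow> 'b) \<Rightarrow> nat \<Rightarrow> 'b set" where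
  "split_U d E Es i = (\<Sum>j\<in>{0..i}. range (Es j)) \<inter> (\<Sum>j\<in>{i..d}. range (E j))"

definition split_U_down :: "nat \<Rightarrow> (nat \<Rightarrow> 'b \<Rightarrow> 'b) \<Rightarrow> (nat \<Rightarrow> 'b \<Rightarrow> 'b) \<Rightarrow> nat \<Rightarrow> 'b set" where
  "split_U_down d E Es i = (\<Sum>j\<in>{0..i}. range (Es j)) \<inter> (\<Sum>j\<in>{0..d - i}. range (E j))"

text \<open>
  This is meaningful when the whole space is the direct sum of \<open>U 0, \<dots>, U d\<close>;
  otherwise no map satisfies the description.
\<close>
definition component_projection :: "nat \<Rightarrow> (nat \<Rightarrow> 'b set) \<Rightarrow> nat \<Rightarrow> 'b \<Rightarrow> 'b" where
  "component_projection d U i = (THE P. is_projection (U i) (\<Sum>j\<in>{0..d} - {i}. U j) P)"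

definition Delta :: "nat \<Rightarrow> (nat \<Rightarrow> 'b \<Rightarrow> 'b) \<Rightarrow> (nat \<Rightarrow> 'b \<Rightarrow> 'b) \<Rightarrow> 'b \<Rightarrow> 'b" where
  "Delta d E Es v =
     (\<Sum>h\<in>{0..d}. component_projection d (split_U_down d E Es) h
                    (component_projection d (split_U d E Es) h v))"

end

end

theory Submission
  imports Defs
begin

text \<open>
  Write \<open>P i\<close> for \<open>E\<^sup>*\<^sub>0 V + \<dots> + E\<^sup>*\<^sub>i\<^sub>-\<^sub>1 V\<close> and \<open>Q i\<close> for \<open>E\<^sub>i V + \<dots> + E\<^sub>d V\<close>,
  so that \<open>U\<^sub>i = P (i + 1) \<inter> Q i\<close>.  The second split decomposition has the same form,
  with \<open>Q\<close> replaced by the flag \<open>R i = E\<^sub>0 V + \<dots> + E\<^sub>d\<^sub>-\<^sub>i V\<close> belonging to the reversed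
  ordering of the eigenspaces of \<open>A\<close>, which is again standard.

  The two hypotheses on \<open>\<Delta>'\<close> pin down its value on each \<open>U\<^sub>h\<close>.  For \<open>u \<in> U\<^sub>h\<close>, the first
  one gives \<open>\<Delta>' u - u \<in> P h\<close>, hence \<open>\<Delta>' u \<in> P (h + 1)\<close>; the second one gives
  \<open>\<Delta>' u \<in> R h\<close>.  So \<open>\<Delta>' u\<close> lies in \<open>U\<^sub>h\<^sup>\<Down>\<close> and differs from \<open>u\<close> by an element of \<open>P h\<close>,
  which is the sum of the \<open>U\<^sub>j\<^sup>\<Down>\<close> with \<open>j < h\<close>.  Therefore \<open>\<Delta>' u = F\<^sub>h\<^sup>\<Down> u = \<Delta> u\<close>, and
  since the \<open>U\<^sub>h\<close> span \<open>V\<close>, the maps agree (\<open>split_projection_eq\<close>, \<open>Delta_unique\<close>).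

  What remains is the existence of both split decompositions.  It follows from
  irreducibility applied to the two diagonal sums \<open>\<Sum>i. P i \<inter> Q i\<close> and
  \<open>\<Sum>i. P (i + 1) \<inter> Q i\<close>: both are invariant under \<open>A\<close> and \<open>A\<^sup>*\<close>
  (\<open>diagonal_sum_trivial\<close>).  The first lies in \<open>Q 1 \<noteq> V\<close>, so it vanishes and the flags are
  opposite (\<open>flags_opposite\<close>); the second contains \<open>P 1 \<noteq> 0\<close>, so it is all of \<open>V\<close>
  (\<open>split_total\<close>).
\<close>

section \<open>Sums of subspaces and projections\<close>

context fin_pos_dim_space
begin

lemma subspace_setsum:
  assumes "finite J" "\<And>j. j \<in> J \<Longrightarrow> subspace (X j)"
  shows "subspace (\<Sum>j\<in>J. X j)"
  using assms
proof (induction J rule: finite_induct)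
  case empty
  then show ?case by (simp add: set_zero)
next
  case (insert k J)
  have "X k + (\<Sum>j\<in>J. X j) = {x + y |x y. x \<in> X k \<and> y \<in> (\<Sum>j\<in>J. X j)}"
    by (auto simp: set_plus_def)
  with insert show ?case by (simp add: subspace_sums)
qed

lemma setsum_elim:
  assumes "finite J" "v \<in> (\<Sum>j\<in>J. X j)"
  obtains x where "\<And>j. j \<in> J \<Longrightarrow> x j \<in> X j" "v = (\<Sum>j\<in>J. x j)"
  using assms by (auto simp: set_sum_alt)

lemma setsum_subset:
  assumes "finite J" "subspace W" "\<And>j. j \<in> J \<Longrightarrow> X j \<subseteq> W"
  shows "(\<Sum>j\<in>J. X j) \<subseteq> W"
  using assms by (auto simp: set_sum_alt intro!: subspace_sum)

lemma setsum_upper: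
  assumes "finite J" "\<And>j. j \<in> J \<Longrightarrow> subspace (X j)" "i \<in> J"
  shows "X i \<subseteq> (\<Sum>j\<in>J. X j)"
proof
  fix v assume v: "v \<in> X i"
  let ?x = "\<lambda>j. if j = i then v else 0"
  have "sum ?x J = v" using assms by simp
  moreover have "\<forall>j\<in>J. ?x j \<in> X j"
    using v assms by (auto intro: subspace_0)
  ultimately have "\<exists>x. v = sum x J \<and> (\<forall>j\<in>J. x j \<in> X j)"
    by (intro exI[of _ ?x]) simp
  then show "v \<in> (\<Sum>j\<in>J. X j)" by (simp add: set_sum_alt[OF assms(1)])
qed

lemma setsum_mono:
  assumes "finite J'" "\<And>j. j \<in> J' \<Longrightarrow> subspace (X j)" "J \<subseteq> J'"
  shows "(\<Sum>j\<in>J. X j) \<subseteq> (\<Sum>j\<in>J'. X j)"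
proof (rule setsum_subset)
  show "finite J" using assms(1,3) by (rule finite_subset[rotated])
  show "subspace (\<Sum>j\<in>J'. X j)" using assms(1,2) by (rule subspace_setsum)
  show "X j \<subseteq> (\<Sum>j\<in>J'. X j)" if "j \<in> J" for j
    using assms that by (intro setsum_upper) auto
qed

lemma projection_unique:
  assumes P: "is_projection W W' P" and R: "is_projection W W' R"
  shows "P = R"
proof
  fix v
  interpret P: Vector_Spaces.linear scale scale P using P by (simp add: is_projection_def)
  interpret R: Vector_Spaces.linear scale scale R using R by (simp add: is_projection_def)
  have RR: "R (R v) = R v" for v
    using R unfolding is_projection_def by (metis comp_apply)
  have PP: "P (P v) = P v" for v
    using P unfolding is_projection_def by (metis comp_apply)
  have "R (v - R v) = 0" by (simp add: R.diff RR)
  then have "v - R v \<in> {v. P v = 0}"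
    using P R unfolding is_projection_def by auto
  then have "P v = P (R v)" by (simp add: P.diff)
  moreover have "R v \<in> range P"
    using P R unfolding is_projection_def by auto
  ultimately show "P v = R v" using PP by auto
qed

lemma projection_exists:
  assumes W: "subspace W" and W': "subspace W'"
    and disjoint: "W \<inter> W' = {0}" and total: "W + W' = UNIV"
  shows "\<exists>P. is_projection W W' P"
proof -
  have "\<exists>w. w \<in> W \<and> v - w \<in> W'" for v
  proof -
    have "v \<in> W + W'" using total by simp
    then show ?thesis by (auto simp: set_plus_def)
  qed
  then obtain P where PW: "\<And>v. P v \<in> W" and PW': "\<And>v. v - P v \<in> W'" by metis
  have eq: "P v = w" if "w \<in> W" "v - w \<in> W'" for v w
  proof -
    have "P v - w \<in> W" using that PW W by (simp add: subspace_diff)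
    moreover have "(v - w) - (v - P v) \<in> W'" by (rule subspace_diff[OF W' that(2) PW'])
    then have "P v - w \<in> W'" by (simp add: algebra_simps)
    ultimately have "P v - w = 0" using disjoint by blast
    then show ?thesis by simp
  qed
  have "Vector_Spaces.linear scale scale P"
  proof (unfold_locales)
    fix x y
    have "(x - P x) + (y - P y) \<in> W'" using PW' W' by (simp add: subspace_add)
    then show "P (x + y) = P x + P y"
      by (intro eq subspace_add W PW) (simp add: algebra_simps)
  next
    fix r x
    have "r *s (x - P x) \<in> W'" using PW' W' by (simp add: subspace_scale)
    then show "P (r *s x) = r *s P x"
      by (intro eq subspace_scale W PW) (simp add: scale_right_diff_distrib)
  qed
  moreover have fixed: "P w = w" if "w \<in> W" for w
    using that W' by (intro eq) (auto intro: subspace_0)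
  then have "P \<circ> P = P" using PW by auto
  moreover have "range P = W" using PW fixed by (metis image_subset_iff rangeI subsetI subset_antisym)
  moreover have "{v. P v = 0} = W'"
  proof
    show "{v. P v = 0} \<subseteq> W'"
    proof clarify
      fix v assume "P v = 0"
      then show "v \<in> W'" using PW'[of v] by simp
    qed
    show "W' \<subseteq> {v. P v = 0}"
    proof clarify
      fix v assume "v \<in> W'"
      then show "P v = 0" using subspace_0[OF W] by (intro eq) simp_all
    qed
  qed
  ultimately show ?thesis unfolding is_projection_def by blast
qed

text \<open>
  A direct decomposition makes the description of \<open>component_projection\<close> satisfiable, so
  that the definite description really denotes the projection; this turns it into a rule
  for computing components.
\<close>
lemma component_projection_sum:
  assumes sub: "\<And>i. i \<le> d \<Longrightarrow> subspace (U i)"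
    and total: "(\<Sum>i\<in>{0..d}. U i) = UNIV"
    and indep: "\<And>u. (\<And>i. i \<le> d \<Longrightarrow> u i \<in> U i) \<Longrightarrow> (\<Sum>i\<in>{0..d}. u i) = 0 \<Longrightarrow> \<forall>i\<le>d. u i = 0"
    and h: "h \<le> d" and u: "\<And>i. i \<le> d \<Longrightarrow> u i \<in> U i"
  shows "component_projection d U h (\<Sum>i\<in>{0..d}. u i) = u h"
proof -
  let ?W' = "\<Sum>j\<in>{0..d} - {h}. U j"
  have sub': "subspace ?W'" using sub by (intro subspace_setsum) auto
  have disjoint: "U h \<inter> ?W' = {0}"
  proof
    show "U h \<inter> ?W' \<subseteq> {0}"
    proof
      fix w assume w: "w \<in> U h \<inter> ?W'"
      then obtain x where x: "\<And>j. j \<in> {0..d} - {h} \<Longrightarrow> x j \<in> U j"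
          "w = (\<Sum>j\<in>{0..d} - {h}. x j)"
        using setsum_elim[of "{0..d} - {h}" w U] by (metis IntD2 finite_Diff finite_atLeastAtMost)
      let ?y = "\<lambda>j. if j = h then - w else x j"
      have "(\<Sum>j\<in>{0..d}. ?y j) = ?y h + (\<Sum>j\<in>{0..d} - {h}. ?y j)"
        using h by (intro sum.remove) auto
      also have "(\<Sum>j\<in>{0..d} - {h}. ?y j) = w"
        unfolding x(2) by (intro sum.cong) auto
      finally have "(\<Sum>j\<in>{0..d}. ?y j) = 0" by simp
      moreover have "?y j \<in> U j" if "j \<le> d" for j
        using that w x sub by (auto intro: subspace_neg)
      ultimately have "?y h = 0" using indep[of ?y] h by blast
      then show "w \<in> {0}" by simp
    qed
    show "{0} \<subseteq> U h \<inter> ?W'" using sub[OF h] sub' by (auto intro: subspace_0)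
  qed
  have "U h + ?W' = UNIV" using total h by (simp add: sum.remove[of "{0..d}" h])
  then obtain R where R: "is_projection (U h) ?W' R"
    using projection_exists[OF sub[OF h] sub' disjoint] by blast
  have P: "is_projection (U h) ?W' (component_projection d U h)"
    unfolding component_projection_def
    by (rule theI[of "is_projection (U h) ?W'", OF R projection_unique[OF _ R]])
  let ?P = "component_projection d U h"
  interpret P: Vector_Spaces.linear scale scale ?P using P by (simp add: is_projection_def)
  have "(\<Sum>i\<in>{0..d} - {h}. u i) \<in> ?W'" using u by (auto simp: set_sum_alt)
  then have "?P (\<Sum>i\<in>{0..d} - {h}. u i) = 0"
    using P unfolding is_projection_def by auto
  moreover have "?P (u h) = u h"
  proof -
    have "u h \<in> range ?P" using P u[OF h] unfolding is_projection_def by auto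
    then obtain y where "u h = ?P y" by auto
    moreover have "?P (?P y) = ?P y" using P unfolding is_projection_def by (metis comp_apply)
    ultimately show ?thesis by simp
  qed
  moreover have "(\<Sum>i\<in>{0..d}. u i) = u h + (\<Sum>i\<in>{0..d} - {h}. u i)"
    using h by (intro sum.remove) auto
  ultimately show ?thesis by (simp add: P.add)
qed

text \<open>
  The scalar \<open>c\<close> may depend on the summand, which allows a shift by a different eigenvalue
  on each summand.
\<close>
lemma setsum_invariant:
  assumes T: "Vector_Spaces.linear scale scale T"
    and fin: "finite J" and sub: "\<And>j. j \<in> J \<Longrightarrow> subspace (X j)"
    and step: "\<And>j. j \<in> J \<Longrightarrow> \<exists>c. \<forall>v\<in>X j. T v - c *s v \<in> (\<Sum>j\<in>J. X j)"
  shows "T ` (\<Sum>j\<in>J. X j) \<subseteq> (\<Sum>j\<in>J. X j)"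
proof -
  interpret T: Vector_Spaces.linear scale scale T by (rule T)
  let ?W = "\<Sum>j\<in>J. X j"
  have W: "subspace ?W" using fin sub by (rule subspace_setsum)
  have piece: "T v \<in> ?W" if j: "j \<in> J" and v: "v \<in> X j" for j v
  proof -
    obtain c where "T v - c *s v \<in> ?W" using step j v by blast
    moreover have "c *s v \<in> ?W"
      using setsum_upper[of J X, OF fin sub j] v W by (auto intro: subspace_scale)
    ultimately show ?thesis using subspace_add[OF W] by fastforce
  qed
  show ?thesis
  proof clarify
    fix v assume "v \<in> ?W"
    then obtain x where x: "\<And>j. j \<in> J \<Longrightarrow> x j \<in> X j" "v = (\<Sum>j\<in>J. x j)"
      using setsum_elim[OF fin] by metis
    have "T v = (\<Sum>j\<in>J. T (x j))" unfolding x(2) by (rule T.sum)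
    also have "\<dots> \<in> ?W" using x(1) piece by (intro subspace_sum[OF W]) auto
    finally show "T v \<in> ?W" .
  qed
qed

end

section \<open>Split decompositions from a pair of flags\<close>

text \<open>
  Isolates what the construction of a split decomposition uses about a tridiagonal pair and
  a choice of standard orderings, so that it applies to both orderings of the eigenspaces
  of \<open>A\<close>.  The indices run to \<open>d + 1\<close>, so that \<open>P 0 = Q (d + 1) = 0\<close> replaces the
  convention that an eigenspace with index \<open>-1\<close> or \<open>d + 1\<close> is zero.
\<close>
locale split_flags = fin_pos_dim_space scale Basis
  for scale :: "'a::field \<Rightarrow> 'b::ab_group_add \<Rightarrow> 'b" (infixr "*s" 75) and Basis :: "'b set" +
  fixes d :: nat and A As :: "'b \<Rightarrow> 'b" and P Q :: "nat \<Rightarrow> 'b set"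
  assumes linear_A: "Vector_Spaces.linear scale scale A"
    and linear_As: "Vector_Spaces.linear scale scale As"
    and irreducible: "\<And>W. subspace W \<Longrightarrow> A ` W \<subseteq> W \<Longrightarrow> As ` W \<subseteq> W \<Longrightarrow> W = {0} \<or> W = UNIV"
    and subspace_P: "\<And>i. i \<le> Suc d \<Longrightarrow> subspace (P i)"
    and subspace_Q: "\<And>i. i \<le> Suc d \<Longrightarrow> subspace (Q i)"
    and P_Suc: "\<And>i. i \<le> d \<Longrightarrow> P i \<subseteq> P (Suc i)"
    and Q_Suc: "\<And>i. i \<le> d \<Longrightarrow> Q (Suc i) \<subseteq> Q i"
    and P_bot: "P 0 = {0}" and P_1: "P 1 \<noteq> {0}"
    and Q_top: "Q 0 = UNIV" and Q_1: "Q 1 \<noteq> UNIV" and Q_bot: "Q (Suc d) = {0}"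
    and A_Q: "\<And>i. i \<le> d \<Longrightarrow> \<exists>c. \<forall>v\<in>Q i. A v - c *s v \<in> Q (Suc i)"
    and As_P: "\<And>i. i \<le> d \<Longrightarrow> \<exists>c. \<forall>v\<in>P (Suc i). As v - c *s v \<in> P i"
    and A_P: "\<And>i. i \<le> d \<Longrightarrow> A ` P i \<subseteq> P (Suc i)"
    and As_Q: "\<And>i. i \<le> d \<Longrightarrow> As ` Q (Suc i) \<subseteq> Q i"
begin

lemma P_mono: "i \<le> j \<Longrightarrow> j \<le> Suc d \<Longrightarrow> P i \<subseteq> P j"
proof (induction rule: dec_induct)
  case (step n)
  then show ?case using P_Suc[of n] by auto
qed simp

lemma Q_antimono: "i \<le> j \<Longrightarrow> j \<le> Suc d \<Longrightarrow> Q j \<subseteq> Q i"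
proof (induction rule: dec_induct)
  case (step n)
  then show ?case using Q_Suc[of n] by auto
qed simp

text \<open>
  On the summand with index \<open>i\<close>, subtracting a suitable scalar from \<open>A\<close> gives a map into the
  summand with index \<open>i + 1\<close>: the shift moves \<open>Q i\<close> into \<open>Q (i + 1)\<close>, while \<open>A\<close> raises the
  index of \<open>P\<close> by at most one.  In the same way a shift of \<open>A\<^sup>*\<close> maps it into the summand with
  index \<open>i - 1\<close>.  The offset \<open>s\<close> covers both diagonals that are needed: \<open>s = 0\<close>
  shows that the flags are opposite, and \<open>s = 1\<close> gives the split decomposition.
\<close>
lemma diagonal_sum_trivial:
  assumes s: "s \<le> 1"
  defines "W \<equiv> \<Sum>i\<in>{0..d}. P (i + s) \<inter> Q i"
  shows "W = {0} \<or> W = UNIV"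
proof -
  interpret A: Vector_Spaces.linear scale scale A by (rule linear_A)
  interpret As: Vector_Spaces.linear scale scale As by (rule linear_As)
  define X where "X i = P (i + s) \<inter> Q i" for i
  have subX: "subspace (X i)" if "i \<in> {0..d}" for i
    using that s unfolding X_def by (intro subspace_inter subspace_P subspace_Q) auto
  have W: "W = (\<Sum>i\<in>{0..d}. X i)" by (simp add: W_def X_def)
  have subW: "subspace W" unfolding W using subX by (intro subspace_setsum) auto
  have XW: "X i \<subseteq> W" if "i \<le> d" for i
    unfolding W using that subX by (intro setsum_upper) auto
  have "A ` W \<subseteq> W"
    unfolding W
  proof (rule setsum_invariant[OF linear_A _ subX])
    fix i assume i: "i \<in> {0..d}"
    obtain c where c: "\<forall>v\<in>Q i. A v - c *s v \<in> Q (Suc i)" using A_Q[of i] i by auto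
    have "A v - c *s v \<in> W" if v: "v \<in> X i" for v
    proof (cases "i = d")
      case True
      then have "A v - c *s v = 0" using c v Q_bot by (auto simp: X_def)
      then show ?thesis using subW by (simp add: subspace_0)
    next
      case False
      with i s have i': "i + s \<le> d" by auto
      have "A v \<in> P (Suc (i + s))" "v \<in> P (Suc (i + s))"
        using v A_P[OF i'] P_Suc[OF i'] by (auto simp: X_def)
      then have "A v - c *s v \<in> P (Suc (i + s))"
        using subspace_P[of "Suc (i + s)"] i' by (intro subspace_diff subspace_scale) auto
      then have "A v - c *s v \<in> X (Suc i)" using c v by (auto simp: X_def)
      then show ?thesis using XW[of "Suc i"] i False by auto
    qed
    then show "\<exists>c. \<forall>v\<in>X i. A v - c *s v \<in> (\<Sum>j\<in>{0..d}. X j)" unfolding W by blast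
  qed auto
  moreover have "As ` W \<subseteq> W"
    unfolding W
  proof (rule setsum_invariant[OF linear_As _ subX])
    fix i assume i: "i \<in> {0..d}"
    show "\<exists>c. \<forall>v\<in>X i. As v - c *s v \<in> (\<Sum>j\<in>{0..d}. X j)"
    proof (cases "i + s")
      case 0
      then have "As v - 0 *s v \<in> W" if "v \<in> X i" for v
        using that P_bot As.zero subW by (auto simp: X_def subspace_0)
      then show ?thesis unfolding W by blast
    next
      case (Suc k)
      with i s have k: "k \<le> d" by auto
      \<comment> \<open>The summand lies in \<open>P (k + 1)\<close>, and the eigenvalue of \<open>A\<^sup>*\<close> with index \<open>k\<close> is the
        one that moves it down to \<open>P k\<close>; when \<open>i = 0\<close> that means \<open>k = 0\<close> and \<open>P k = 0\<close>.\<close>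
      obtain c where c: "\<forall>v\<in>P (Suc k). As v - c *s v \<in> P k" using As_P[OF k] by auto
      have "As v - c *s v \<in> W" if v: "v \<in> X i" for v
      proof (cases i)
        case 0
        with Suc s have "k = 0" by simp
        then have "As v - c *s v = 0" using c v Suc P_bot by (auto simp: X_def)
        then show ?thesis using subW by (simp add: subspace_0)
      next
        case i': (Suc j)
        with i have j: "j \<le> d" by auto
        have "As v \<in> Q j" "v \<in> Q j"
          using v As_Q[OF j] Q_Suc[OF j] i' by (auto simp: X_def)
        then have "As v - c *s v \<in> Q j"
          using subspace_Q[of j] j by (intro subspace_diff subspace_scale) auto
        moreover have "As v - c *s v \<in> P (j + s)" using c v Suc i' by (auto simp: X_def)
        ultimately have "As v - c *s v \<in> X j" by (simp add: X_def)
        then show ?thesis using XW[OF j] by auto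
      qed
      then show ?thesis unfolding W by blast
    qed
  qed auto
  ultimately show ?thesis using irreducible subW by blast
qed

lemma flags_opposite:
  assumes "i \<le> Suc d"
  shows "P i \<inter> Q i = {0}"
proof (cases "i = Suc d")
  case True
  then show ?thesis using Q_bot subspace_P[of i] by (auto intro: subspace_0)
next
  case False
  let ?W = "\<Sum>i\<in>{0..d}. P (i + 0) \<inter> Q i"
  have sub: "subspace (P (i + 0) \<inter> Q i)" if "i \<in> {0..d}" for i
    using that by (intro subspace_inter subspace_P subspace_Q) auto
  have "?W \<subseteq> Q 1"
  proof (rule setsum_subset)
    show "P (i + 0) \<inter> Q i \<subseteq> Q 1" if "i \<in> {0..d}" for i
      using that P_bot Q_antimono[of 1 i] subspace_0[OF subspace_Q[of 1]] by (cases i) auto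
  qed (auto intro: subspace_Q)
  then have "?W = {0}" using diagonal_sum_trivial[of 0] Q_1 by auto
  moreover have "P (i + 0) \<inter> Q i \<subseteq> ?W"
    using assms False sub by (intro setsum_upper) auto
  ultimately show ?thesis using sub[of i] assms False by (auto dest: subspace_0)
qed

lemma split_total: "(\<Sum>i\<in>{0..d}. P (Suc i) \<inter> Q i) = UNIV"
proof -
  have "P (Suc 0) \<inter> Q 0 \<subseteq> (\<Sum>i\<in>{0..d}. P (Suc i) \<inter> Q i)"
    by (rule setsum_upper[where X = "\<lambda>i. P (Suc i) \<inter> Q i"])
      (auto intro!: subspace_inter subspace_P subspace_Q)
  then have "(\<Sum>i\<in>{0..d}. P (Suc i) \<inter> Q i) \<noteq> {0}"
    using P_1 Q_top subspace_0[OF subspace_P[of 1]] by auto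
  then show ?thesis using diagonal_sum_trivial[of 1] by simp
qed

text \<open>
  The tail lies in \<open>Q k\<close>, and it is the difference of the whole sum and its head, which both
  lie in \<open>P k\<close>; opposite flags leave only zero.
\<close>
lemma split_tail_zero:
  assumes k: "k \<le> Suc d" and u: "\<And>i. i \<le> d \<Longrightarrow> u i \<in> P (Suc i) \<inter> Q i"
    and v: "(\<Sum>i\<in>{0..d}. u i) \<in> P k"
  shows "(\<Sum>i\<in>{k..d}. u i) = 0"
proof -
  have "(\<Sum>i\<in>{0..<k}. u i) \<in> P k"
  proof (intro subspace_sum subspace_P k)
    fix i assume "i \<in> {0..<k}"
    then show "u i \<in> P k" using u[of i] k P_mono[of "Suc i" k] by auto
  qed
  then have "(\<Sum>i\<in>{0..d}. u i) - (\<Sum>i\<in>{0..<k}. u i) \<in> P k"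
    using v k by (intro subspace_diff subspace_P)
  moreover have "{0..d} = {0..<k} \<union> {k..d}" using k by auto
  then have "(\<Sum>i\<in>{0..d}. u i) = (\<Sum>i\<in>{0..<k}. u i) + (\<Sum>i\<in>{k..d}. u i)"
    using sum.union_disjoint[of "{0..<k}" "{k..d}" u] by (simp add: ivl_disj_int)
  moreover have "(\<Sum>i\<in>{k..d}. u i) \<in> Q k"
  proof (intro subspace_sum subspace_Q k)
    fix i assume "i \<in> {k..d}"
    then show "u i \<in> Q k" using u[of i] Q_antimono[of k i] by auto
  qed
  ultimately show ?thesis using flags_opposite[OF k] by auto
qed

text \<open>
  For \<open>k = 0\<close> this is the independence of the summands; for general \<open>k\<close> it shows that \<open>P k\<close>
  is contained in the sum of the first \<open>k\<close> components.
\<close>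
lemma split_sum_in_P:
  assumes "k \<le> Suc d" and u: "\<And>i. i \<le> d \<Longrightarrow> u i \<in> P (Suc i) \<inter> Q i"
    and v: "(\<Sum>i\<in>{0..d}. u i) \<in> P k" and i: "k \<le> i" "i \<le> d"
  shows "u i = 0"
proof -
  have "(\<Sum>j\<in>{i..d}. u j) = 0"
    using i v P_mono[of k i] by (intro split_tail_zero u) auto
  moreover have "(\<Sum>j\<in>{Suc i..d}. u j) = 0"
    using i v P_mono[of k "Suc i"] by (intro split_tail_zero u) auto
  ultimately show ?thesis using i by (simp add: sum.atLeast_Suc_atMost)
qed

lemma split_projection_sum:
  assumes "h \<le> d" "\<And>i. i \<le> d \<Longrightarrow> u i \<in> P (Suc i) \<inter> Q i"
  shows "component_projection d (\<lambda>i. P (Suc i) \<inter> Q i) h (\<Sum>i\<in>{0..d}. u i) = u h"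
proof (rule component_projection_sum[OF _ split_total _ assms])
  show "subspace (P (Suc i) \<inter> Q i)" if "i \<le> d" for i
    using that by (intro subspace_inter subspace_P subspace_Q) auto
next
  fix w assume w: "\<And>i. i \<le> d \<Longrightarrow> w i \<in> P (Suc i) \<inter> Q i" "(\<Sum>i\<in>{0..d}. w i) = 0"
  show "\<forall>i\<le>d. w i = 0"
  proof (intro allI impI)
    fix i assume "i \<le> d"
    moreover have "(\<Sum>i\<in>{0..d}. w i) \<in> P 0" by (simp add: w(2) P_bot)
    ultimately show "w i = 0" by (intro split_sum_in_P[of 0 w, OF _ w(1)]) auto
  qed
qed

lemma split_component:
  "\<exists>u. (\<forall>i\<le>d. u i \<in> P (Suc i) \<inter> Q i) \<and> v = (\<Sum>i\<in>{0..d}. u i)"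
proof -
  have "v \<in> (\<Sum>i\<in>{0..d}. P (Suc i) \<inter> Q i)" using split_total by simp
  then obtain u where "v = (\<Sum>i\<in>{0..d}. u i)" "\<forall>i\<in>{0..d}. u i \<in> P (Suc i) \<inter> Q i"
    unfolding set_sum_alt[OF finite_atLeastAtMost] by blast
  then show ?thesis by (intro exI[of _ u]) auto
qed

text \<open>
  The component projections are triangular with respect to the flag \<open>P\<close>: the one with index
  \<open>h\<close> kills \<open>P h\<close> and fixes its own component, so \<open>v\<close> and \<open>w\<close> have the same image.
\<close>
lemma split_projection_eq:
  assumes h: "h \<le> d" and w: "w \<in> P (Suc h) \<inter> Q h" and diff: "w - v \<in> P h"
  shows "component_projection d (\<lambda>i. P (Suc i) \<inter> Q i) h v = w"
proof -
  obtain u where u: "\<And>i. i \<le> d \<Longrightarrow> u i \<in> P (Suc i) \<inter> Q i" "v = (\<Sum>i\<in>{0..d}. u i)"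
    using split_component[of v] by blast
  \<comment> \<open>The components of \<open>w - v\<close>, where \<open>w\<close> contributes only to the one with index \<open>h\<close>.\<close>
  define x where "x i = (if i = h then w - u i else - u i)" for i
  have x: "x i \<in> P (Suc i) \<inter> Q i" if "i \<le> d" for i
    using that u(1)[OF that] w unfolding x_def
    by (auto intro!: subspace_diff subspace_neg subspace_P subspace_Q)
  have "x = (\<lambda>i. (if i = h then w else 0) - u i)" by (auto simp: x_def)
  then have "(\<Sum>i\<in>{0..d}. x i) = w - v" using h by (simp add: sum_subtractf u(2))
  then have "x h = 0" using split_sum_in_P[OF _ x] diff h by auto
  then have "u h = w" by (simp add: x_def)
  then show ?thesis using split_projection_sum[OF h u(1)] u(2) by simp
qed

end

section \<open>Flags of sums of eigenspaces\<close>

context fin_pos_dim_space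
begin

lemma subspace_eigenspace:
  assumes "Vector_Spaces.linear scale scale T"
  shows "subspace (eigenspace T \<theta>)"
proof -
  interpret T: Vector_Spaces.linear scale scale T by (rule assms)
  show ?thesis
    by (rule subspaceI) (simp_all add: eigenspace_def T.add T.scale scale_right_distrib scale_left_commute)
qed

lemma shifted_eigenspace_sum:
  assumes T: "Vector_Spaces.linear scale scale T" and J: "finite J"
    and W: "\<And>j. j \<in> J \<Longrightarrow> W j = eigenspace T (\<theta> j)"
    and v: "v \<in> (\<Sum>j\<in>J. W j)"
  shows "T v - \<theta> k *s v \<in> (\<Sum>j\<in>J - {k}. W j)"
proof -
  interpret T: Vector_Spaces.linear scale scale T by (rule T)
  obtain x where x: "\<And>j. j \<in> J \<Longrightarrow> x j \<in> W j" "v = (\<Sum>j\<in>J. x j)"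
    using v J by (auto elim: setsum_elim[rotated])
  have "T v - \<theta> k *s v = (\<Sum>j\<in>J. T (x j) - \<theta> k *s x j)"
    by (simp add: x(2) T.sum scale_sum_right sum_subtractf)
  also have "\<dots> = (\<Sum>j\<in>J. (\<theta> j - \<theta> k) *s x j)"
    using x(1) W by (intro sum.cong) (auto simp: eigenspace_def scale_left_diff_distrib)
  also have "\<dots> = (\<Sum>j\<in>J - {k}. (\<theta> j - \<theta> k) *s x j)"
    using J by (intro sum.mono_neutral_right) auto
  also have "\<dots> \<in> (\<Sum>j\<in>J - {k}. W j)"
    unfolding set_sum_alt[OF finite_Diff[OF J]]
    using x(1) W subspace_eigenspace[OF T] by (auto intro!: subspace_scale)
  finally show ?thesis .
qed

text \<open>
  Applying \<open>T - \<theta> k\<close> to \<open>v\<close> multiplies it by the nonzero scalar \<open>\<mu> - \<theta> k\<close> and removes the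
  summand with index \<open>k\<close>, so the summands can be dropped one after the other.
\<close>
lemma eigenvector_notin_sum:
  assumes T: "Vector_Spaces.linear scale scale T" and "finite J"
    and "\<And>j. j \<in> J \<Longrightarrow> W j = eigenspace T (\<theta> j)" and "\<And>j. j \<in> J \<Longrightarrow> \<theta> j \<noteq> \<mu>"
    and "T v = \<mu> *s v" and "v \<in> (\<Sum>j\<in>J. W j)"
  shows "v = 0"
  using assms(2-)
proof (induction J rule: finite_induct)
  case empty
  then show ?case by (simp add: set_zero)
next
  case (insert k J)
  have "T v - \<theta> k *s v \<in> (\<Sum>j\<in>insert k J - {k}. W j)"
    using insert by (intro shifted_eigenspace_sum[OF T]) auto
  then have "(\<mu> - \<theta> k) *s v \<in> (\<Sum>j\<in>J. W j)"
    using insert by (simp add: scale_left_diff_distrib)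
  moreover have "subspace (\<Sum>j\<in>J. W j)"
    using insert by (intro subspace_setsum) (auto intro: subspace_eigenspace[OF T])
  ultimately have "inverse (\<mu> - \<theta> k) *s (\<mu> - \<theta> k) *s v \<in> (\<Sum>j\<in>J. W j)"
    by (rule subspace_scale[rotated])
  moreover have "inverse (\<mu> - \<theta> k) *s (\<mu> - \<theta> k) *s v = v"
    using insert.prems(2)[of k] by simp
  ultimately have "v \<in> (\<Sum>j\<in>J. W j)" by (simp only:)
  then show ?case using insert by auto
qed

lemma standard_ordering_rev:
  assumes "standard_ordering T S d W"
  shows "standard_ordering T S d (\<lambda>i. W (d - i))"
proof -
  have "bij_betw (\<lambda>i. d - i) {0..d} {0..d}"
    by (rule bij_betw_byWitness[where f' = "\<lambda>i. d - i"]) auto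
  then have "bij_betw (W \<circ> (\<lambda>i. d - i)) {0..d} (eigenspaces T)"
    using assms unfolding standard_ordering_def by (intro bij_betw_trans) auto
  moreover have "S ` W (d - i) \<subseteq> (if i = 0 then {0} else W (d - (i - 1))) + W (d - i) +
      (if i = d then {0} else W (d - (i + 1)))" if i: "i \<le> d" for i
  proof -
    have "S ` W (d - i) \<subseteq> (if d - i = 0 then {0} else W (d - i - 1)) + W (d - i) +
        (if d - i = d then {0} else W (d - i + 1))"
    proof -
      have "\<forall>k\<le>d. S ` W k \<subseteq> (if k = 0 then {0} else W (k - 1)) + W k +
          (if k = d then {0} else W (k + 1))"
        using assms unfolding standard_ordering_def by blast
      then show ?thesis using diff_le_self by blast
    qed
    moreover have "(if d - i = 0 then {0} else W (d - i - 1)) = (if i = d then {0} else W (d - (i + 1)))"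
      using i by auto
    moreover have "(if d - i = d then {0} else W (d - i + 1)) = (if i = 0 then {0} else W (d - (i - 1)))"
    proof (cases "i = 0")
      case False
      then have "d - (i - 1) = d - i + 1" using i by auto
      then show ?thesis using False i by auto
    qed simp
    ultimately show ?thesis by (simp add: ac_simps)
  qed
  ultimately show ?thesis unfolding standard_ordering_def by (simp add: comp_def)
qed

lemma standard_ordering_eigenvalues:
  assumes "standard_ordering T S d W"
  obtains \<theta> where "\<And>i. i \<le> d \<Longrightarrow> W i = eigenspace T (\<theta> i)" "inj_on \<theta> {0..d}"
    "\<And>i. i \<le> d \<Longrightarrow> \<exists>v\<in>W i. v \<noteq> 0"
proof -
  have bij: "bij_betw W {0..d} (eigenspaces T)" using assms by (simp add: standard_ordering_def)
  have "\<exists>\<theta>. W i = eigenspace T \<theta> \<and> (\<exists>v\<in>W i. v \<noteq> 0)" if "i \<le> d" for i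
  proof -
    have "W i \<in> eigenspaces T" using bij that by (auto simp: bij_betw_def)
    then show ?thesis by (auto simp: eigenspaces_def eigenspace_def)
  qed
  then obtain \<theta> where \<theta>: "\<And>i. i \<le> d \<Longrightarrow> W i = eigenspace T (\<theta> i) \<and> (\<exists>v\<in>W i. v \<noteq> 0)" by metis
  moreover have "inj_on \<theta> {0..d}"
    using bij \<theta> by (auto simp: bij_betw_def inj_on_def)
  ultimately show ?thesis using that by blast
qed

text \<open>
  The condition on \<open>J'\<close> says that it contains every index at distance at most one from \<open>J\<close>.
\<close>
lemma neighbour_sum:
  assumes S: "Vector_Spaces.linear scale scale S" and ord: "standard_ordering T S d W"
    and sub: "\<And>i. i \<le> d \<Longrightarrow> subspace (W i)"
    and J: "J \<subseteq> {0..d}" and J': "J' \<subseteq> {0..d}"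
    and near: "\<And>j i. j \<in> J \<Longrightarrow> i \<le> d \<Longrightarrow> j \<le> Suc i \<Longrightarrow> i \<le> Suc j \<Longrightarrow> i \<in> J'"
  shows "S ` (\<Sum>j\<in>J. W j) \<subseteq> (\<Sum>j\<in>J'. W j)"
proof -
  interpret S: Vector_Spaces.linear scale scale S by (rule S)
  let ?V = "\<Sum>j\<in>J'. W j"
  have fin: "finite J" "finite J'" using J J' by (auto intro: finite_subset)
  have V: "subspace ?V" using fin J' sub by (intro subspace_setsum) auto
  have up: "W i \<subseteq> ?V" if "i \<in> J'" for i
    using fin J' sub that by (intro setsum_upper) auto
  have piece: "S w \<in> ?V" if j: "j \<in> J" and w: "w \<in> W j" for j w
  proof -
    have jd: "j \<le> d" using j J by auto
    have "S w \<in> (if j = 0 then {0} else W (j - 1)) + W j + (if j = d then {0} else W (j + 1))"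
      using ord jd w unfolding standard_ordering_def by blast
    then obtain a b c where abc: "S w = a + b + c" "a \<in> (if j = 0 then {0} else W (j - 1))"
      "b \<in> W j" "c \<in> (if j = d then {0} else W (j + 1))"
      by (auto elim!: set_plus_elim)
    have "a \<in> ?V"
      using abc(2) up[of "j - 1"] near[OF j, of "j - 1"] jd subspace_0[OF V] by (auto split: if_splits)
    moreover have "b \<in> ?V" using abc(3) up[OF near[OF j, of j]] jd by auto
    moreover have "c \<in> ?V"
      using abc(4) up[OF near[OF j, of "j + 1"]] jd subspace_0[OF V] by (auto split: if_splits)
    ultimately show ?thesis using V by (simp add: abc(1) subspace_add)
  qed
  show ?thesis
  proof clarify
    fix v assume "v \<in> (\<Sum>j\<in>J. W j)"
    then obtain x where x: "\<And>j. j \<in> J \<Longrightarrow> x j \<in> W j" "v = (\<Sum>j\<in>J. x j)"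
      using setsum_elim[OF fin(1)] by metis
    have "S v = (\<Sum>j\<in>J. S (x j))" unfolding x(2) by (rule S.sum)
    also have "\<dots> \<in> ?V" using x(1) piece by (intro subspace_sum[OF V]) auto
    finally show "S v \<in> ?V" .
  qed
qed

lemma split_flags_of_standard_orderings:
  assumes pair: "TD_pair A As"
    and W: "standard_ordering A As d W" and Ws: "standard_ordering As A d Ws"
  shows "split_flags scale Basis d A As (\<lambda>i. \<Sum>j\<in>{..<i}. Ws j) (\<lambda>i. \<Sum>j\<in>{i..d}. W j)"
proof -
  have A: "Vector_Spaces.linear scale scale A" and As: "Vector_Spaces.linear scale scale As"
    using pair by (auto simp: TD_pair_def diagonalizable_def)
  obtain \<theta> where \<theta>: "\<And>i. i \<le> d \<Longrightarrow> W i = eigenspace A (\<theta> i)" "inj_on \<theta> {0..d}"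
    "\<And>i. i \<le> d \<Longrightarrow> \<exists>v\<in>W i. v \<noteq> 0"
    using standard_ordering_eigenvalues[OF W] by metis
  obtain \<theta>s where \<theta>s: "\<And>i. i \<le> d \<Longrightarrow> Ws i = eigenspace As (\<theta>s i)"
    "\<And>i. i \<le> d \<Longrightarrow> \<exists>v\<in>Ws i. v \<noteq> 0"
    using standard_ordering_eigenvalues[OF Ws] by metis
  have subW: "subspace (W i)" if "i \<le> d" for i
    using that \<theta>(1) subspace_eigenspace[OF A] by simp
  have subWs: "subspace (Ws i)" if "i \<le> d" for i
    using that \<theta>s(1) subspace_eigenspace[OF As] by simp
  show ?thesis
  proof (intro split_flags.intro split_flags_axioms.intro fin_pos_dim_space_axioms A As)
    fix V assume "subspace V" "A ` V \<subseteq> V" "As ` V \<subseteq> V"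
    then show "V = {0} \<or> V = UNIV" using pair unfolding TD_pair_def by blast
  next
    fix i assume i: "i \<le> Suc d"
    show "subspace (\<Sum>j\<in>{..<i}. Ws j)" using i subWs by (intro subspace_setsum) auto
    show "subspace (\<Sum>j\<in>{i..d}. W j)" using subW by (intro subspace_setsum) auto
  next
    fix i assume i: "i \<le> d"
    show "(\<Sum>j\<in>{..<i}. Ws j) \<subseteq> (\<Sum>j\<in>{..<Suc i}. Ws j)"
      using i subWs by (intro setsum_mono) auto
    show "(\<Sum>j\<in>{Suc i..d}. W j) \<subseteq> (\<Sum>j\<in>{i..d}. W j)"
      using subW by (intro setsum_mono) auto
    show "\<exists>c. \<forall>v\<in>\<Sum>j\<in>{i..d}. W j. A v - c *s v \<in> (\<Sum>j\<in>{Suc i..d}. W j)"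
    proof (intro exI ballI)
      fix v assume "v \<in> (\<Sum>j\<in>{i..d}. W j)"
      then have "A v - \<theta> i *s v \<in> (\<Sum>j\<in>{i..d} - {i}. W j)"
        using \<theta>(1) by (intro shifted_eigenspace_sum[OF A]) auto
      moreover have "{i..d} - {i} = {Suc i..d}" by auto
      ultimately show "A v - \<theta> i *s v \<in> (\<Sum>j\<in>{Suc i..d}. W j)" by simp
    qed
    show "\<exists>c. \<forall>v\<in>\<Sum>j\<in>{..<Suc i}. Ws j. As v - c *s v \<in> (\<Sum>j\<in>{..<i}. Ws j)"
    proof (intro exI ballI)
      fix v assume "v \<in> (\<Sum>j\<in>{..<Suc i}. Ws j)"
      then have "As v - \<theta>s i *s v \<in> (\<Sum>j\<in>{..<Suc i} - {i}. Ws j)"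
        using \<theta>s(1) i by (intro shifted_eigenspace_sum[OF As]) auto
      moreover have "{..<Suc i} - {i} = {..<i}" by auto
      ultimately show "As v - \<theta>s i *s v \<in> (\<Sum>j\<in>{..<i}. Ws j)" by simp
    qed
    show "A ` (\<Sum>j\<in>{..<i}. Ws j) \<subseteq> (\<Sum>j\<in>{..<Suc i}. Ws j)"
      using i subWs by (intro neighbour_sum[OF A Ws]) auto
    show "As ` (\<Sum>j\<in>{Suc i..d}. W j) \<subseteq> (\<Sum>j\<in>{i..d}. W j)"
      using i subW by (intro neighbour_sum[OF As W]) auto
  next
    show "(\<Sum>j\<in>{..<0}. Ws j) = {0}" by (simp add: set_zero)
    show "(\<Sum>j\<in>{..<1}. Ws j) \<noteq> {0}" using \<theta>s(2)[of 0] by auto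
    show "(\<Sum>j\<in>{Suc d..d}. W j) = {0}" by (simp add: set_zero)
    have total: "subspace (\<Sum>j\<in>{0..d}. W j)" using subW by (intro subspace_setsum) auto
    have "\<Union>(eigenspaces A) = (\<Union>j\<in>{0..d}. W j)"
      using W by (auto simp: standard_ordering_def bij_betw_def)
    also have "\<dots> \<subseteq> (\<Sum>j\<in>{0..d}. W j)"
      using subW by (intro UN_least setsum_upper) auto
    finally have "span (\<Union>(eigenspaces A)) \<subseteq> (\<Sum>j\<in>{0..d}. W j)"
      by (rule span_minimal) (rule total)
    then show "(\<Sum>j\<in>{0..d}. W j) = UNIV"
      using pair by (auto simp: TD_pair_def diagonalizable_def)
    obtain v where v: "v \<in> W 0" "v \<noteq> 0" using \<theta>(3)[of 0] by auto
    have "v \<notin> (\<Sum>j\<in>{1..d}. W j)"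
    proof
      assume "v \<in> (\<Sum>j\<in>{1..d}. W j)"
      moreover have "\<theta> j \<noteq> \<theta> 0" if "j \<in> {1..d}" for j
        using inj_onD[OF \<theta>(2), of j 0] that by auto
      ultimately have "v = 0"
        using v(1) \<theta>(1)
        by (intro eigenvector_notin_sum[OF A, of "{1..d}" W \<theta> "\<theta> 0"]) (auto simp: eigenspace_def)
      with v show False by simp
    qed
    then show "(\<Sum>j\<in>{1..d}. W j) \<noteq> UNIV" by auto
  qed
qed

lemma component_projection_cong:
  assumes "\<And>i. i \<le> d \<Longrightarrow> U i = U' i" "h \<le> d"
  shows "component_projection d U h = component_projection d U' h"
proof -
  have "(\<Sum>j\<in>{0..d} - {h}. U j) = (\<Sum>j\<in>{0..d} - {h}. U' j)"
    using assms(1) by (intro sum.cong) auto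
  then show ?thesis using assms by (simp add: component_projection_def)
qed

text \<open>
  On the component with index \<open>h\<close> of the first decomposition, \<open>D\<close> takes values in the
  component with the same index of the second one and differs from the identity by elements
  of \<open>P h\<close>; by \<open>split_projection_eq\<close> it is the projection onto that component there.
\<close>
lemma Delta_unique:
  assumes TD: "TD_system d A E As Es"
    and lin: "Vector_Spaces.linear scale scale D"
    and low: "\<And>i. i \<le> d \<Longrightarrow> (\<lambda>v. D v - v) ` range (Es i) \<subseteq> (\<Sum>j\<in>{..<i}. range (Es j))"
    and flip: "\<And>i. i \<le> d \<Longrightarrow> D ` (\<Sum>j\<in>{i..d}. range (E j)) \<subseteq> (\<Sum>j\<in>{0..d - i}. range (E j))"
  shows "D = Delta d E Es"
proof
  fix v
  interpret D: Vector_Spaces.linear scale scale D by (rule lin)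
  define P where "P i = (\<Sum>j\<in>{..<i}. range (Es j))" for i
  define Q where "Q i = (\<Sum>j\<in>{i..d}. range (E j))" for i
  define R where "R i = (\<Sum>j\<in>{i..d}. range (E (d - j)))" for i
  have pair: "TD_pair A As" and ord: "standard_ordering A As d (\<lambda>i. range (E i))"
    and ords: "standard_ordering As A d (\<lambda>i. range (Es i))"
    using TD by (auto simp: TD_system_def)
  interpret U: split_flags scale Basis d A As P Q
    unfolding P_def Q_def by (rule split_flags_of_standard_orderings[OF pair ord ords])
  interpret Down: split_flags scale Basis d A As P R
    unfolding P_def R_def
    by (rule split_flags_of_standard_orderings[OF pair standard_ordering_rev[OF ord] ords])
  have R: "R i = (\<Sum>j\<in>{0..d - i}. range (E j))" if "i \<le> d" for i
    unfolding R_def using that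
    by (intro sum.reindex_bij_witness[where i = "\<lambda>j. d - j" and j = "\<lambda>j. d - j"]) auto
  have P: "(\<Sum>j\<in>{0..i}. range (Es j)) = P (Suc i)" for i
    by (simp add: P_def lessThan_Suc_atMost atLeast0AtMost)
  have split: "component_projection d (split_U d E Es) h =
      component_projection d (\<lambda>i. P (Suc i) \<inter> Q i) h" if "h \<le> d" for h
    using that by (intro component_projection_cong) (simp_all add: split_U_def P Q_def)
  have split_down: "component_projection d (split_U_down d E Es) h =
      component_projection d (\<lambda>i. P (Suc i) \<inter> R i) h" if "h \<le> d" for h
    using that by (intro component_projection_cong) (simp_all add: split_U_down_def P R)
  have shift: "D p - p \<in> P i" if i: "i \<le> d" and p: "p \<in> P (Suc i)" for i p
  proof -
    obtain x where x: "\<And>j. j \<in> {..<Suc i} \<Longrightarrow> x j \<in> range (Es j)" "p = (\<Sum>j\<in>{..<Suc i}. x j)"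
      using p unfolding P_def by (elim setsum_elim[rotated]) auto
    have "D p - p = (\<Sum>j\<in>{..<Suc i}. D (x j) - x j)"
      by (simp only: x(2) D.sum sum_subtractf)
    also have "\<dots> \<in> P i"
    proof (intro subspace_sum U.subspace_P)
      fix j assume j: "j \<in> {..<Suc i}"
      then have "D (x j) - x j \<in> P j" using low[of j] x(1)[of j] i unfolding P_def by auto
      then show "D (x j) - x j \<in> P i" using U.P_mono[of j i] j i by auto
    qed (use i in simp)
    finally show ?thesis .
  qed
  obtain u where u: "\<And>i. i \<le> d \<Longrightarrow> u i \<in> P (Suc i) \<inter> Q i" "v = (\<Sum>i\<in>{0..d}. u i)"
    using U.split_component[of v] by blast
  have "component_projection d (split_U_down d E Es) h
      (component_projection d (split_U d E Es) h v) = D (u h)" if h: "h \<le> d" for h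
  proof -
    have "D (u h) - u h \<in> P h" using shift[OF h] u(1)[OF h] by auto
    moreover have "D (u h) \<in> R h"
      using flip[OF h] u(1)[OF h] unfolding R[OF h] Q_def by auto
    moreover have "D (u h) \<in> P (Suc h)"
    proof -
      have "(D (u h) - u h) + u h \<in> P (Suc h)"
        using calculation(1) u(1)[OF h] U.P_Suc[OF h] h by (intro subspace_add U.subspace_P) auto
      then show ?thesis by simp
    qed
    ultimately have "component_projection d (\<lambda>i. P (Suc i) \<inter> R i) h (u h) = D (u h)"
      using h by (intro Down.split_projection_eq) auto
    then show ?thesis
      by (simp add: split[OF h] split_down[OF h] u(2) U.split_projection_sum[OF h u(1)])
  qed
  then have "Delta d E Es v = (\<Sum>h\<in>{0..d}. D (u h))"
    unfolding Delta_def by (intro sum.cong) auto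
  then show "D v = Delta d E Es v" by (simp add: u(2) D.sum)
qed

end

theorem lemma9p9:
  fixes scale :: "'k::field \<Rightarrow> 'v::ab_group_add \<Rightarrow> 'v"
    and Basis :: "'v set"
    and d :: nat
    and A As \<Delta>' :: "'v \<Rightarrow> 'v"
    and E Es :: "nat \<Rightarrow> 'v \<Rightarrow> 'v"
  assumes "fin_pos_dim_space scale Basis"
    and "fin_pos_dim_space.TD_system scale d A E As Es"
    and "d \<ge> 1"
    and "Vector_Spaces.linear scale scale \<Delta>'"
    and "\<forall>i\<le>d. (\<lambda>v. \<Delta>' v - v) ` range (Es i) \<subseteq> (\<Sum>j\<in>{..<i}. range (Es j))"
    and "\<forall>i\<le>d. \<Delta>' ` (\<Sum>j\<in>{i..d}. range (E j)) \<subseteq> (\<Sum>j\<in>{0..d - i}. range (E j))"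
  shows "\<Delta>' = fin_pos_dim_space.Delta scale d E Es"
  using fin_pos_dim_space.Delta_unique[OF assms(1,2,4)] assms(5,6) by blast

end
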